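(* Let $\lambda>-\frac12$, $\lambda\ne0$, $1<p<\infty$, $\alpha\in\mathbb{R}$, and let $w(t)=t^\alpha$ on $\mathbb{R}_+$. Then: (1) $w\in A_p$ if and only if $-1<\alpha<p-1$. (2) $w\in A_{p,\lambda}$ if and only if $-1-p<\alpha<p-1+2\lambda p$. (3) $w\in\widetilde A_{p,\lambda}$ if and only if $-1<\alpha<p-1+(2\lambda+1)p$.
   Context: $\mathbb{R}_+=(0,\infty)$; intervals $B\subset\mathbb{R}_+$ are intervals $(a,b)$ with $0\le a<b<\infty$; $\nu_\lambda(B)=\int_Bt^{2\lambda+1}dt$; $p'=p/(p-1)$. For a non-negative measurable $w$ on $\mathbb{R}_+$: $w\in A_p$ (classical Muckenhoupt class on $\mathbb{R}_+$ with Lebesgue measure) if $\sup_{B\subset\mathbb{R}_+}\big(\frac1{|B|}\int_Bw\,dt\big)\big(\frac1{|B|}\int_Bw^{-\frac1{p-1}}dt\big)^{p-1}<\infty$. $w\in A_{p,\lambda}$ if there is $C>0$ such that for all $0<a<b<\infty$, $\big(\int_a^bt^pw(t)dt\big)\big(\int_a^bt^{2\lambda p'}w(t)^{-\frac1{p-1}}dt\big)^{p-1}<C\big(b^{2(\lambda+1)}-a^{2(\lambda+1)}\big)^p$. $w\in\widetilde A_{p,\lambda}$ if there is $C>0$ such that for all intervals $B\subset\mathbb{R}_+$, $\big(\frac1{\nu_\lambda(B)}\int_Bw(t)dt\big)\big(\frac1{\nu_\lambda(B)}\int_Bt^{(2\lambda+1)p'}w(t)^{-\frac1{p-1}}dt\big)^{p-1}<C$.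 *)

theory Defs
  imports "HOL-Analysis.Analysis"
begin

text \<open>
  Real powers of extended non-negative numbers, with the conventions
  \<open>0\<^sup>s = \<infinity>\<close> and \<open>\<infinity>\<^sup>s = 0\<close> for \<open>s < 0\<close>, and \<open>0\<^sup>s = 0\<close> and \<open>\<infinity>\<^sup>s = \<infinity>\<close> for \<open>s > 0\<close>.
  They are needed because the integrals below may be infinite and because a weight may vanish
  (on the reals, \<open>0 powr s = 0\<close> also for \<open>s < 0\<close>).
\<close>

definition epowr :: "ennreal \<Rightarrow> real \<Rightarrow> ennreal" (infixr \<open>epowr\<close> 80) where
  "x epowr s =
    (if s = 0 then 1
     else if x = 0 then (if s < 0 then \<infinity> else 0)
     else if x = \<infinity> then (if s < 0 then 0 else \<infinity>)
     else ennreal (enn2real x powr s))"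

definition conj_exp :: "real \<Rightarrow> real" where
  "conj_exp p = p / (p - 1)"

text \<open>
  Functions on \<open>(0,\<infinity>)\<close> are rendered as functions on the reals whose values outside \<open>(0,\<infinity>)\<close>
  are irrelevant.
\<close>

definition weight :: "(real \<Rightarrow> real) \<Rightarrow> bool" where
  "weight w \<longleftrightarrow> (\<forall>t>0. 0 \<le> w t) \<and> w \<in> borel_measurable (lebesgue_on {0<..})"

definition nu :: "real \<Rightarrow> real set \<Rightarrow> ennreal" where
  "nu l B = (\<integral>\<^sup>+t\<in>B. ennreal (t powr (2 * l + 1)) \<partial>lebesgue)"

definition Rplus_intervals :: "real set set" where
  "Rplus_intervals = {{a<..<b} | a b. 0 \<le> a \<and> a < b}"

text \<open>
  The integrals take values in \<open>[0,\<infinity>]\<close>; as usual in measure theory, \<open>0 * \<infinity> = 0\<close>.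
\<close>

definition muckenhoupt_A :: "real \<Rightarrow> (real \<Rightarrow> real) set" where
  "muckenhoupt_A p = {w. weight w \<and>
     (SUP B \<in> Rplus_intervals.
        ((\<integral>\<^sup>+t\<in>B. ennreal (w t) \<partial>lebesgue) / emeasure lebesgue B) *
        ((\<integral>\<^sup>+t\<in>B. ennreal (w t) epowr (- 1 / (p - 1)) \<partial>lebesgue)
            / emeasure lebesgue B) epowr (p - 1)) < \<infinity>}"

definition muckenhoupt_A_lam :: "real \<Rightarrow> real \<Rightarrow> (real \<Rightarrow> real) set" where
  "muckenhoupt_A_lam p l = {w. weight w \<and>
     (\<exists>C>0. \<forall>a b. 0 < a \<and> a < b \<longrightarrow>
        (\<integral>\<^sup>+t\<in>{a<..<b}. ennreal (t powr p * w t) \<partial>lebesgue) *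
        (\<integral>\<^sup>+t\<in>{a<..<b}. ennreal (t powr (2 * l * conj_exp p))
            * ennreal (w t) epowr (- 1 / (p - 1)) \<partial>lebesgue) epowr (p - 1)
        < ennreal (C * (b powr (2 * (l + 1)) - a powr (2 * (l + 1))) powr p))}"

definition muckenhoupt_A_tilde :: "real \<Rightarrow> real \<Rightarrow> (real \<Rightarrow> real) set" where
  "muckenhoupt_A_tilde p l = {w. weight w \<and>
     (\<exists>C>0. \<forall>B \<in> Rplus_intervals.
        ((\<integral>\<^sup>+t\<in>B. ennreal (w t) \<partial>lebesgue) / nu l B) *
        ((\<integral>\<^sup>+t\<in>B. ennreal (t powr ((2 * l + 1) * conj_exp p))
            * ennreal (w t) epowr (- 1 / (p - 1)) \<partial>lebesgue) / nu l B) epowr (p - 1)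
        < ennreal C)}"

end

theory Submission
  imports Defs
begin

text \<open>
  Write \<open>J s\<close> for the integral of \<open>t\<^sup>s\<close> over \<open>(a, b)\<close>. All three conditions have the form
  \<open>J \<gamma> * (J \<delta>) powr (p - 1) \<le> C * (J \<kappa>) powr p\<close> with \<open>\<kappa> > -1\<close> and the homogeneity relation
  \<open>\<gamma> + (p - 1) * \<delta> = p * \<kappa>\<close>, and the claimed ranges of \<open>\<alpha>\<close> say that \<open>\<gamma>, \<delta> > -1\<close>.
  For \<open>s > -1\<close>, Bernoulli's inequality makes \<open>J s\<close> comparable to \<open>b powr s * (b - a)\<close>, so these
  inequalities suffice. They are necessary because otherwise \<open>J \<gamma>\<close> or \<open>J \<delta>\<close> over \<open>(a, 1)\<close>
  diverges as \<open>a\<close> tends to \<open>0\<close>, while \<open>J \<kappa>\<close> stays bounded and the other factor stays away from \<open>0\<close>.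
\<close>

section \<open>Differences of powers\<close>

text \<open>Scaling by \<open>b\<close> reduces both bounds to comparing 1 - x^m with 1 - x for
  \<open>x = a / b\<close> in [0, 1). One bound is the tangent line of x^m at 1, the other the
  comparison of x^m with x; passing from m \<le> 1 to m > 1 swaps their roles, which
  \<open>min 1 m\<close> and \<open>max 1 m\<close> record.\<close>

lemma powr_diff_bounds:
  fixes a b m :: real
  assumes "0 \<le> a" "a < b" "0 < m"
  shows "min 1 m * (b powr (m - 1) * (b - a)) \<le> b powr m - a powr m"
    and "b powr m - a powr m \<le> max 1 m * (b powr (m - 1) * (b - a))"
proof -
  define x where "x = a / b"
  have x: "0 \<le> x" "x < 1" and a: "a = b * x" and b: "0 < b"
    using assms by (auto simp: x_def)
  have bernoulli: "min 1 m * (1 - x) \<le> 1 - x powr m \<and> 1 - x powr m \<le> max 1 m * (1 - x)"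
  proof (cases "x = 0")
    case True
    then show ?thesis using assms by auto
  next
    case False
    with x have x0: "0 < x" by simp
    show ?thesis
    proof (cases "m \<le> 1")
      case True
      \<comment> \<open>Bernoulli for m \<le> 1, as the weighted AM-GM inequality for the numbers x
        and 1 with weights m and 1 - m.\<close>
      have "x powr m * 1 powr (1 - m) \<le> m * x + (1 - m) * 1"
        using True x0 assms by (intro Youngs_inequality_0) auto
      moreover have "x powr 1 \<le> x powr m"
        using True x x0 by (intro powr_mono') auto
      ultimately show ?thesis
        using True x0 by (auto simp: algebra_simps)
    next
      case False
      \<comment> \<open>For m > 1 the weight is 1/m and the inequality is applied to x^m in place of
        x, which reverses the tangent-line bound.\<close>
      have "(x powr m) powr (1 / m) * 1 powr (1 - 1 / m) \<le> 1 / m * x powr m + (1 - 1 / m) * 1"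
        using False x0 by (intro Youngs_inequality_0) auto
      then have "m * x \<le> m * (1 / m * x powr m + (1 - 1 / m) * 1)"
        using assms x0 by (simp add: powr_powr)
      then have "m * x \<le> x powr m + (m - 1)"
        using assms by (simp add: algebra_simps)
      moreover have "x powr m \<le> x powr 1"
        using False x x0 by (intro powr_mono') auto
      ultimately show ?thesis
        using False x0 by (auto simp: algebra_simps)
    qed
  qed
  have diff: "b powr m - a powr m = b powr m * (1 - x powr m)"
    using b x by (simp add: a powr_mult algebra_simps)
  have scale: "b powr (m - 1) * (b - a) = b powr m * (1 - x)"
    using b by (simp add: a powr_diff field_simps)
  have c: "0 \<le> b powr m" by simp
  show "min 1 m * (b powr (m - 1) * (b - a)) \<le> b powr m - a powr m"
    using mult_left_mono[OF conjunct1[OF bernoulli] c]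
    unfolding diff scale by (simp only: mult_ac)
  show "b powr m - a powr m \<le> max 1 m * (b powr (m - 1) * (b - a))"
    using mult_left_mono[OF conjunct2[OF bernoulli] c]
    unfolding diff scale by (simp only: mult_ac)
qed

section \<open>Integrals of powers over intervals\<close>

text \<open>Values lie in [0, \<infinity>], so the notation also covers the divergent case s \<le>
  -1, a = 0.\<close>

definition power_integral :: "real \<Rightarrow> real \<Rightarrow> real \<Rightarrow> ennreal" where
  "power_integral s a b = (\<integral>\<^sup>+t\<in>{a<..<b}. ennreal (t powr s) \<partial>lebesgue)"

lemma power_integral_eqI:
  assumes eq: "\<And>t. a < t \<Longrightarrow> t < b \<Longrightarrow> f t = ennreal (t powr s)"
  shows "(\<integral>\<^sup>+t\<in>{a<..<b}. f t \<partial>lebesgue) = power_integral s a b"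
  unfolding power_integral_def using eq
  by (intro nn_integral_cong) (auto simp: indicator_def)

text \<open>Differentiability is asked only in the interior, so that powers can be integrated from
  the endpoint 0; nonnegativity turns the gauge integral into a Lebesgue integral.\<close>

lemma nn_set_integral_Ioo_FTC:
  fixes F f :: "real \<Rightarrow> real"
  assumes "a \<le> b" "continuous_on {a..b} F"
    and "\<And>t. a < t \<Longrightarrow> t < b \<Longrightarrow> (F has_real_derivative f t) (at t)"
    and nonneg: "\<And>t. a < t \<Longrightarrow> t < b \<Longrightarrow> 0 \<le> f t"
  shows "(\<integral>\<^sup>+t\<in>{a<..<b}. ennreal (f t) \<partial>lebesgue) = ennreal (F b - F a)"
proof -
  have "(f has_integral (F b - F a)) {a..b}"
    using assms by (intro fundamental_theorem_of_calculus_interior)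
      (auto simp: has_real_derivative_iff_has_vector_derivative)
  then have "(f has_integral (F b - F a)) {a<..<b}"
    by (simp add: has_integral_Icc_iff_Ioo)
  with nonneg have "integral\<^sup>N lborel (\<lambda>t. ennreal (f t) * indicator {a<..<b} t) = ennreal (F b - F a)"
    by (intro nn_integral_has_integral_lebesgue') auto
  then show ?thesis by (simp add: nn_integral_completion)
qed

lemma power_integral_eq:
  assumes "0 \<le> a" "a < b" "- 1 < s"
  shows "power_integral s a b = ennreal ((b powr (s + 1) - a powr (s + 1)) / (s + 1))"
proof -
  have "power_integral s a b = ennreal (b powr (s + 1) / (s + 1) - a powr (s + 1) / (s + 1))"
    unfolding power_integral_def
  proof (rule nn_set_integral_Ioo_FTC)
    \<comment> \<open>Continuity at 0, relevant for a = 0, comes from s + 1 > 0.\<close>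
    show "continuous_on {a..b} (\<lambda>t. t powr (s + 1) / (s + 1))"
      using assms by (intro continuous_intros continuous_on_powr') auto
    show "((\<lambda>t. t powr (s + 1) / (s + 1)) has_real_derivative t powr s) (at t)" if "a < t" for t
      using that assms by (auto intro!: derivative_eq_intros)
  qed (use assms in auto)
  then show ?thesis by (simp add: diff_divide_distrib)
qed

text \<open>These are the bounds of \<open>powr_diff_bounds\<close> with m = s + 1, divided by s +
  1. The constants depend on s alone, hence are uniform over all intervals.\<close>

lemma power_integral_comparable:
  assumes "- 1 < s"
  obtains c C where "0 < c" "0 < C"
    "\<And>a b. 0 \<le> a \<Longrightarrow> a < b \<Longrightarrow> ennreal (c * (b powr s * (b - a))) \<le> power_integral s a b"
    "\<And>a b. 0 \<le> a \<Longrightarrow> a < b \<Longrightarrow> power_integral s a b \<le> ennreal (C * (b powr s * (b - a)))"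
proof (rule that)
  show "0 < min 1 (s + 1) / (s + 1)" "0 < max 1 (s + 1) / (s + 1)"
    using assms by auto
  fix a b :: real assume ab: "0 \<le> a" "a < b"
  note bounds = powr_diff_bounds[OF ab, of "s + 1"]
  show "ennreal (min 1 (s + 1) / (s + 1) * (b powr s * (b - a))) \<le> power_integral s a b"
    using ab assms bounds(1) unfolding power_integral_eq[OF ab assms]
    by (intro ennreal_leI) (simp add: divide_right_mono)
  show "power_integral s a b \<le> ennreal (max 1 (s + 1) / (s + 1) * (b powr s * (b - a)))"
    using ab assms bounds(2) unfolding power_integral_eq[OF ab assms]
    by (intro ennreal_leI) (simp add: divide_right_mono)
qed

section \<open>Rules for real powers on [0, \<infinity>]\<close>

lemma epowr_ennreal: "0 \<le> x \<Longrightarrow> 0 < s \<Longrightarrow> ennreal x epowr s = ennreal (x powr s)"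
  by (auto simp: epowr_def)

lemma epowr_mono: "x \<le> y \<Longrightarrow> 0 < s \<Longrightarrow> x epowr s \<le> y epowr s"
  by (cases x; cases y) (auto simp: epowr_def powr_mono2 ennreal_leI top_unique)

lemma epowr_divide_ennreal:
  assumes "0 < n" "0 < s"
  shows "(x / ennreal n) epowr s = x epowr s / ennreal (n powr s)"
proof (cases x)
  case (real r)
  then show ?thesis
    using assms by (simp add: divide_ennreal epowr_ennreal powr_divide)
next
  case top
  then show ?thesis
    using assms by (simp add: ennreal_top_divide epowr_def)
qed

lemma ennreal_powr_epowr:
  assumes "0 < t" "0 < r"
  shows "ennreal (t powr x) epowr - (1 / r) = ennreal (t powr - (x / r))"
  using assms by (simp add: epowr_def powr_powr)

section \<open>Lower bounds on (a, 1) for small a\<close>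

text \<open>Only (1/2, 1) is used, where the monotone function t^s is at least the smaller of its
  endpoint values. The bound is independent of a, so it keeps one factor away from 0 while the other
  diverges.\<close>

lemma power_integral_ge_half:
  assumes "a \<le> 1 / 2"
  shows "ennreal (min 1 ((1/2) powr s) / 2) \<le> power_integral s a 1"
proof -
  have m: "min 1 ((1/2) powr s) \<le> t powr s" if "1/2 < t" "t < 1" for t :: real
  proof (cases "0 \<le> s")
    case True
    then have "(1/2) powr s \<le> t powr s" using that by (intro powr_mono2) auto
    then show ?thesis by simp
  next
    case False
    then have "1 powr s \<le> t powr s" using that by (intro powr_mono2') auto
    then show ?thesis by simp
  qed
  have "ennreal (min 1 ((1/2) powr s) / 2)
      = (\<integral>\<^sup>+t\<in>{1/2<..<1::real}. ennreal (min 1 ((1/2) powr s)) \<partial>lebesgue)"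
    by (subst nn_set_integral_Ioo_FTC[where F = "\<lambda>t. min 1 ((1/2) powr s) * t"])
      (auto intro!: derivative_eq_intros continuous_intros simp: field_simps)
  also have "\<dots> \<le> power_integral s a 1"
    unfolding power_integral_def using m assms
    by (intro nn_integral_mono) (auto simp: indicator_def intro!: ennreal_leI)
  finally show ?thesis .
qed

text \<open>On (0, 1) the integrand dominates 1/t, whose integral diverges logarithmically as a
  tends to 0.\<close>

lemma power_integral_ge_ln:
  assumes "0 < a" "a < 1" "s \<le> - 1"
  shows "ennreal (- ln a) \<le> power_integral s a 1"
proof -
  have "(\<integral>\<^sup>+t\<in>{a<..<1}. ennreal (1 / t) \<partial>lebesgue) = ennreal (ln 1 - ln a)"
    using assms by (intro nn_set_integral_Ioo_FTC)
      (auto intro!: derivative_eq_intros continuous_intros)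
  then have "ennreal (- ln a) = (\<integral>\<^sup>+t\<in>{a<..<1}. ennreal (1 / t) \<partial>lebesgue)"
    by simp
  also have "\<dots> \<le> power_integral s a 1"
    unfolding power_integral_def
  proof (intro nn_integral_mono)
    fix t
    show "ennreal (1 / t) * indicator {a<..<1} t \<le> ennreal (t powr s) * indicator {a<..<1} t"
    proof (cases "t \<in> {a<..<1}")
      case True
      then have "t powr - 1 \<le> t powr s"
        using assms by (intro powr_mono') auto
      with True assms show ?thesis
        by (auto simp: powr_minus field_simps intro!: ennreal_leI)
    qed auto
  qed
  finally show ?thesis .
qed

section \<open>Sufficiency and necessity for products of power integrals\<close>

lemma muckenhoupt_power_sufficient:
  assumes p: "1 < p" and "- 1 < \<gamma>" "- 1 < \<delta>" "- 1 < \<kappa>" and eq: "\<gamma> + (p - 1) * \<delta> = p * \<kappa>"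
  obtains C where "0 < C"
    "\<And>a b. 0 \<le> a \<Longrightarrow> a < b \<Longrightarrow>
      power_integral \<gamma> a b * power_integral \<delta> a b epowr (p - 1)
        < ennreal C * power_integral \<kappa> a b epowr p"
proof -
  obtain C1 where C1: "0 < C1" "\<And>a b. 0 \<le> a \<Longrightarrow> a < b \<Longrightarrow>
      power_integral \<gamma> a b \<le> ennreal (C1 * (b powr \<gamma> * (b - a)))"
    using power_integral_comparable[OF \<open>- 1 < \<gamma>\<close>] by metis
  obtain C2 where C2: "0 < C2" "\<And>a b. 0 \<le> a \<Longrightarrow> a < b \<Longrightarrow>
      power_integral \<delta> a b \<le> ennreal (C2 * (b powr \<delta> * (b - a)))"
    using power_integral_comparable[OF \<open>- 1 < \<delta>\<close>] by metis
  obtain c where c: "0 < c" "\<And>a b. 0 \<le> a \<Longrightarrow> a < b \<Longrightarrow>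
      ennreal (c * (b powr \<kappa> * (b - a))) \<le> power_integral \<kappa> a b"
    using power_integral_comparable[OF \<open>- 1 < \<kappa>\<close>] by metis
  \<comment> \<open>The summand 1 makes the final inequality strict; dividing by c^p compensates for
    the lower bound on the integral with exponent \<kappa>.\<close>
  define C where "C = (C1 * C2 powr (p - 1) + 1) / c powr p"
  have C: "0 < C" using C1 C2 c by (simp add: C_def add_nonneg_pos)
  show ?thesis
  proof (rule that[OF C])
    fix a b :: real assume ab: "0 \<le> a" "a < b"
    define X where "X = (b powr \<kappa> * (b - a)) powr p"
    have X: "0 < X" using ab by (simp add: X_def)
    \<comment> \<open>Homogeneity enters here: the powers of b match exactly, and the powers of b -
      a match because 1 + (p - 1) = p. Hence the bound does not depend on the interval.\<close>
    have "b powr \<gamma> * (b powr \<delta>) powr (p - 1) = (b powr \<kappa>) powr p"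
      using ab eq by (simp add: powr_powr mult.commute flip: powr_add)
    moreover have "(b - a) * (b - a) powr (p - 1) = (b - a) powr p"
      using ab by (simp add: powr_diff)
    ultimately have "(b powr \<gamma> * (b powr \<delta>) powr (p - 1)) * ((b - a) * (b - a) powr (p - 1)) = X"
      using ab by (simp add: X_def powr_mult)
    then have factor: "(b powr \<gamma> * (b - a)) * (b powr \<delta> * (b - a)) powr (p - 1) = X"
      using ab by (simp add: powr_mult mult_ac)
    have "power_integral \<gamma> a b * power_integral \<delta> a b epowr (p - 1)
        \<le> ennreal (C1 * (b powr \<gamma> * (b - a))) * ennreal (C2 * (b powr \<delta> * (b - a))) epowr (p - 1)"
      using C1(2)[OF ab] C2(2)[OF ab] p by (intro mult_mono epowr_mono) auto
    also have "\<dots> = ennreal (C1 * (b powr \<gamma> * (b - a)) * (C2 * (b powr \<delta> * (b - a))) powr (p - 1))"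
      using ab C1 C2 p by (subst epowr_ennreal) (auto simp flip: ennreal_mult)
    also have "C1 * (b powr \<gamma> * (b - a)) * (C2 * (b powr \<delta> * (b - a))) powr (p - 1)
        = C1 * C2 powr (p - 1) * X"
      unfolding factor[symmetric] using ab C2 by (subst powr_mult) (auto simp: mult_ac)
    also have "ennreal \<dots> < ennreal ((C1 * C2 powr (p - 1) + 1) * X)"
      using X C1 C2 by (intro ennreal_lessI) (auto intro!: mult_pos_pos add_nonneg_pos)
    also have "(C1 * C2 powr (p - 1) + 1) * X = C * (c * (b powr \<kappa> * (b - a))) powr p"
      using c ab by (simp add: C_def X_def powr_mult)
    also have "ennreal \<dots> = ennreal C * ennreal (c * (b powr \<kappa> * (b - a))) epowr p"
      using C c ab p by (subst epowr_ennreal) (auto simp: ennreal_mult)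
    also have "\<dots> \<le> ennreal C * power_integral \<kappa> a b epowr p"
      using c(2)[OF ab] p by (intro mult_left_mono epowr_mono) auto
    finally show "power_integral \<gamma> a b * power_integral \<delta> a b epowr (p - 1)
        < ennreal C * power_integral \<kappa> a b epowr p" .
  qed
qed

text \<open>The test intervals (a, 1) have a > 0, so the criterion also serves
  \<open>muckenhoupt_A_lam\<close>, whose intervals stay away from 0.\<close>

lemma muckenhoupt_power_necessary:
  assumes p: "1 < p" and \<kappa>: "- 1 < \<kappa>"
    and bound: "\<And>a b. 0 < a \<Longrightarrow> a < b \<Longrightarrow>
      power_integral \<gamma> a b * power_integral \<delta> a b epowr (p - 1)
        < ennreal C * power_integral \<kappa> a b epowr p"
  shows "- 1 < \<gamma>" "- 1 < \<delta>"
proof -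
  \<comment> \<open>The integral of t^\<kappa> over (a, 1) is at most 1 / (\<kappa> + 1), so M
    bounds the right-hand side for every a.\<close>
  define M where "M = C * (1 / (\<kappa> + 1)) powr p"
  have bound_M: "power_integral \<gamma> a 1 * power_integral \<delta> a 1 epowr (p - 1) < ennreal M"
    if "0 < a" "a < 1" for a
  proof -
    have "power_integral \<kappa> a 1 \<le> ennreal (1 / (\<kappa> + 1))"
      using that \<kappa> by (auto simp: power_integral_eq divide_right_mono intro!: ennreal_leI)
    then have "ennreal C * power_integral \<kappa> a 1 epowr p \<le> ennreal C * ennreal (1 / (\<kappa> + 1)) epowr p"
      using p by (intro mult_left_mono epowr_mono) auto
    also have "\<dots> = ennreal M"
      using p \<kappa> by (subst epowr_ennreal) (auto simp: M_def simp flip: ennreal_mult'')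
    finally show ?thesis using bound[of a 1] that by auto
  qed
  \<comment> \<open>Taking a = \<open>exp (- r)\<close> turns the logarithmic lower bound into r
    itself; r \<ge> 1 gives a \<le> 1/2, as the bound from (1/2, 1) requires.\<close>
  have exp_small: "0 < exp (- r)" "exp (- r) \<le> 1 / 2" "exp (- r) < 1" if "1 \<le> r" for r :: real
  proof -
    have "2 \<le> exp r" using exp_ge_add_one_self[of r] that by linarith
    then show "0 < exp (- r)" "exp (- r) \<le> 1 / 2" "exp (- r) < 1"
      using that by (auto simp: exp_minus field_simps)
  qed
  define d where "d s = min 1 ((1/2) powr s) / 2" for s :: real
  have d: "0 < d s" for s by (simp add: d_def)
  have ge_half: "ennreal (d s) \<le> power_integral s (exp (- r)) 1" if "1 \<le> r" for s r
    unfolding d_def using exp_small[OF that] by (intro power_integral_ge_half) auto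
  have ge_ln: "ennreal r \<le> power_integral s (exp (- r)) 1" if "1 \<le> r" "s \<le> - 1" for s r
    using power_integral_ge_ln[of "exp (- r)" s] exp_small[OF that(1)] that by simp
  show "- 1 < \<gamma>"
  proof (rule ccontr)
    assume "\<not> - 1 < \<gamma>"
    define D where "D = d \<delta> powr (p - 1)"
    \<comment> \<open>Chosen so that r * D \<ge> M, where D bounds the second factor from
      below.\<close>
    define r where "r = max 1 (M / D)"
    have D: "0 < D" using d[of \<delta>] by (simp add: D_def)
    have r: "1 \<le> r" by (simp add: r_def)
    have "ennreal M \<le> ennreal (r * D)"
      using D by (intro ennreal_leI) (simp add: r_def flip: pos_divide_le_eq)
    also have "\<dots> = ennreal r * ennreal (d \<delta>) epowr (p - 1)"
      using r p d[of \<delta>] by (subst epowr_ennreal) (auto simp: D_def ennreal_mult)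
    also have "\<dots> \<le> power_integral \<gamma> (exp (- r)) 1 * power_integral \<delta> (exp (- r)) 1 epowr (p - 1)"
      using p r \<open>\<not> - 1 < \<gamma>\<close> by (intro mult_mono epowr_mono ge_ln ge_half) auto
    also have "\<dots> < ennreal M"
      using exp_small[OF r] by (intro bound_M)
    finally show False by simp
  qed
  show "- 1 < \<delta>"
  proof (rule ccontr)
    assume "\<not> - 1 < \<delta>"
    define N where "N = max 1 (M / d \<gamma>)"
    \<comment> \<open>The divergent factor now occurs to the power p - 1, so r is the root with r^(p
      - 1) = N, and d \<gamma> * N \<ge> M.\<close>
    define r where "r = N powr (1 / (p - 1))"
    have r: "1 \<le> r" using p by (simp add: r_def N_def ge_one_powr_ge_zero)
    have "ennreal M \<le> ennreal (d \<gamma> * N)"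
      using d[of \<gamma>] by (intro ennreal_leI) (simp add: N_def mult.commute[of "d _"] flip: pos_divide_le_eq)
    also have "N = r powr (p - 1)"
      using p by (simp add: r_def N_def powr_powr)
    also have "ennreal (d \<gamma> * r powr (p - 1)) = ennreal (d \<gamma>) * ennreal r epowr (p - 1)"
      using r p d[of \<gamma>] by (subst epowr_ennreal) (auto simp: ennreal_mult)
    also have "\<dots> \<le> power_integral \<gamma> (exp (- r)) 1 * power_integral \<delta> (exp (- r)) 1 epowr (p - 1)"
      using p r \<open>\<not> - 1 < \<delta>\<close> by (intro mult_mono epowr_mono ge_ln ge_half) auto
    also have "\<dots> < ennreal M"
      using exp_small[OF r] by (intro bound_M)
    finally show False by simp
  qed
qed

section \<open>Conditions stated with averages\<close>

lemma ennreal_divide_less_iff: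
  assumes "0 < r"
  shows "x / ennreal r < c \<longleftrightarrow> x < c * ennreal r"
proof -
  have "x / ennreal r * ennreal r = x"
    using assms by (simp add: ennreal_divide_times ennreal_mult_divide_eq)
  then show ?thesis
    using assms ennreal_mult_strict_right_mono[of "x / ennreal r" c "ennreal r"]
      mult_right_mono[of c "x / ennreal r" "ennreal r"]
    by (metis ennreal_less_top ennreal_less_zero_iff linorder_not_less zero_le)
qed

text \<open>The normalizations 1/n and 1/n^(p - 1) combine to 1/n^p, which turns averages into the
  product form; \<open>x\<close> and \<open>y\<close> may be infinite.\<close>

lemma normalized_product_less_iff:
  assumes "0 < n" "1 < p"
  shows "x / ennreal n * (y / ennreal n) epowr (p - 1) < c \<longleftrightarrow>
    x * y epowr (p - 1) < c * ennreal n epowr p"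
proof -
  have "x / ennreal n * (y / ennreal n) epowr (p - 1)
      = x / ennreal n * (y epowr (p - 1) / ennreal (n powr (p - 1)))"
    using assms by (simp add: epowr_divide_ennreal)
  also have "\<dots> = x * y epowr (p - 1) * (inverse (ennreal n) * inverse (ennreal (n powr (p - 1))))"
    by (simp add: divide_ennreal_def mult_ac)
  also have "inverse (ennreal n) * inverse (ennreal (n powr (p - 1))) = inverse (ennreal (n powr p))"
    using assms by (simp add: inverse_ennreal powr_diff divide_inverse flip: ennreal_mult)
  finally have "x / ennreal n * (y / ennreal n) epowr (p - 1) = x * y epowr (p - 1) / ennreal (n powr p)"
    by (simp add: divide_ennreal_def)
  then show ?thesis
    using assms by (simp add: ennreal_divide_less_iff epowr_ennreal)
qed

text \<open>Common form of \<open>muckenhoupt_A\<close> (\<kappa> = 0) and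
  \<open>muckenhoupt_A_tilde\<close> (\<kappa> = 2l + 1): the normalizing measure is the integral of
  t^\<kappa>, which is finite and positive, so it can be cleared.\<close>

lemma muckenhoupt_power_normalized_iff:
  assumes p: "1 < p" and \<kappa>: "- 1 < \<kappa>" and eq: "\<gamma> + (p - 1) * \<delta> = p * \<kappa>"
  shows "(\<exists>C>0. \<forall>a b. 0 \<le> a \<and> a < b \<longrightarrow>
      power_integral \<gamma> a b / power_integral \<kappa> a b *
      (power_integral \<delta> a b / power_integral \<kappa> a b) epowr (p - 1) < ennreal C)
    \<longleftrightarrow> - 1 < \<gamma> \<and> - 1 < \<delta>"
proof -
  have iff: "power_integral \<gamma> a b / power_integral \<kappa> a b *
      (power_integral \<delta> a b / power_integral \<kappa> a b) epowr (p - 1) < c \<longleftrightarrow>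
      power_integral \<gamma> a b * power_integral \<delta> a b epowr (p - 1) < c * power_integral \<kappa> a b epowr p"
    if "0 \<le> a" "a < b" for a b c
  proof -
    have "a powr (\<kappa> + 1) < b powr (\<kappa> + 1)"
      using that \<kappa> by (intro powr_less_mono2) auto
    then show ?thesis
      unfolding power_integral_eq[OF that \<kappa>] using p \<kappa>
      by (intro normalized_product_less_iff) auto
  qed
  show ?thesis
  proof
    assume "- 1 < \<gamma> \<and> - 1 < \<delta>"
    then obtain C where "0 < C" "\<And>a b. 0 \<le> a \<Longrightarrow> a < b \<Longrightarrow>
      power_integral \<gamma> a b * power_integral \<delta> a b epowr (p - 1)
        < ennreal C * power_integral \<kappa> a b epowr p"
      using muckenhoupt_power_sufficient[OF p _ _ \<kappa> eq] by metis
    then show "\<exists>C>0. \<forall>a b. 0 \<le> a \<and> a < b \<longrightarrow>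
      power_integral \<gamma> a b / power_integral \<kappa> a b *
      (power_integral \<delta> a b / power_integral \<kappa> a b) epowr (p - 1) < ennreal C"
      using iff by blast
  next
    assume "\<exists>C>0. \<forall>a b. 0 \<le> a \<and> a < b \<longrightarrow>
      power_integral \<gamma> a b / power_integral \<kappa> a b *
      (power_integral \<delta> a b / power_integral \<kappa> a b) epowr (p - 1) < ennreal C"
    then obtain C where "\<And>a b. 0 < a \<Longrightarrow> a < b \<Longrightarrow>
      power_integral \<gamma> a b * power_integral \<delta> a b epowr (p - 1)
        < ennreal C * power_integral \<kappa> a b epowr p"
      using iff by (metis less_imp_le)
    then show "- 1 < \<gamma> \<and> - 1 < \<delta>"
      using muckenhoupt_power_necessary[OF p \<kappa>] by blast
  qed
qed

section \<open>Power weights in the three classes\<close>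

lemma weight_powr:
  assumes "\<And>t. t > 0 \<Longrightarrow> w t = t powr \<alpha>"
  shows "weight w"
proof -
  have "(\<lambda>t. t powr \<alpha>) \<in> borel_measurable (lebesgue_on {0<..})"
    by (intro measurable_restrict_space1 measurable_completion) simp
  then have "w \<in> borel_measurable (lebesgue_on {0<..})"
    by (rule measurable_cong[THEN iffD1, rotated]) (simp add: assms)
  then show ?thesis
    using assms by (simp add: weight_def)
qed

lemma nu_Ioo: "nu l {a<..<b} = power_integral (2 * l + 1) a b"
  by (simp add: nu_def power_integral_def)

lemma ball_Rplus_intervals:
  "(\<forall>B\<in>Rplus_intervals. P B) \<longleftrightarrow> (\<forall>a b. 0 \<le> a \<and> a < b \<longrightarrow> P {a<..<b})"
  unfolding Rplus_intervals_def by auto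

text \<open>All integrands of the three definitions are powers of t for this weight;
  \<open>0 \<le> a\<close> keeps the integration where \<open>w\<close> is prescribed.\<close>

lemma weight_integrals:
  assumes "\<And>t. t > 0 \<Longrightarrow> w t = t powr \<alpha>" "1 < p" "0 \<le> a"
  shows "(\<integral>\<^sup>+t\<in>{a<..<b}. ennreal (w t) \<partial>lebesgue) = power_integral \<alpha> a b"
    and "(\<integral>\<^sup>+t\<in>{a<..<b}. ennreal (t powr q * w t) \<partial>lebesgue) = power_integral (q + \<alpha>) a b"
    and "(\<integral>\<^sup>+t\<in>{a<..<b}. ennreal (w t) epowr (- 1 / (p - 1)) \<partial>lebesgue)
      = power_integral (- \<alpha> / (p - 1)) a b"
    and "(\<integral>\<^sup>+t\<in>{a<..<b}. ennreal (t powr q) * ennreal (w t) epowr (- 1 / (p - 1)) \<partial>lebesgue)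
      = power_integral (q - \<alpha> / (p - 1)) a b"
  using assms
  by (auto intro!: power_integral_eqI simp: ennreal_powr_epowr simp flip: ennreal_mult powr_add)

text \<open>Brings the supremum in \<open>muckenhoupt_A\<close> to the strict-bound form of the
  other two classes; adding 1 to the supremum gives a strict and positive bound.\<close>

lemma SUP_less_top_iff_bounded:
  fixes f :: "'a \<Rightarrow> ennreal"
  shows "(SUP x\<in>A. f x) < top \<longleftrightarrow> (\<exists>C>0. \<forall>x\<in>A. f x < ennreal C)"
proof
  assume "(SUP x\<in>A. f x) < top"
  then obtain c where c: "0 \<le> c" "(SUP x\<in>A. f x) = ennreal c"
    by (metis less_top_ennreal)
  have "f x < ennreal (c + 1)" if "x \<in> A" for x
  proof -
    have "f x \<le> ennreal c" unfolding c(2)[symmetric] using that by (rule SUP_upper)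
    also have "\<dots> < ennreal (c + 1)" using c by (intro ennreal_lessI) auto
    finally show ?thesis .
  qed
  with c show "\<exists>C>0. \<forall>x\<in>A. f x < ennreal C"
    by (intro exI[of _ "c + 1"]) auto
next
  assume "\<exists>C>0. \<forall>x\<in>A. f x < ennreal C"
  then obtain C where "\<forall>x\<in>A. f x < ennreal C" by blast
  then have "(SUP x\<in>A. f x) \<le> ennreal C"
    by (intro SUP_least) (auto intro: less_imp_le)
  then show "(SUP x\<in>A. f x) < top"
    by (rule le_less_trans) simp
qed

text \<open>The exponent of t^(q p') w^(-1/(p - 1)) equals (q p - \<alpha>) / (p - 1). The first
  claim feeds the homogeneity relation, the second yields the upper limit for \<alpha>.\<close>

lemma dual_exponent:
  assumes "1 < p"
  shows "(p - 1) * (q * conj_exp p - \<alpha> / (p - 1)) = q * p - \<alpha>"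
    and "- 1 < q * conj_exp p - \<alpha> / (p - 1) \<longleftrightarrow> \<alpha> < p - 1 + q * p"
proof -
  have "q * conj_exp p - \<alpha> / (p - 1) = (q * p - \<alpha>) / (p - 1)"
    by (simp add: conj_exp_def diff_divide_distrib)
  then show "(p - 1) * (q * conj_exp p - \<alpha> / (p - 1)) = q * p - \<alpha>"
    and "- 1 < q * conj_exp p - \<alpha> / (p - 1) \<longleftrightarrow> \<alpha> < p - 1 + q * p"
    using assms by (auto simp: pos_less_divide_eq)
qed

theorem proposition1p5:
  fixes l p \<alpha> :: real and w :: "real \<Rightarrow> real"
  assumes "l > - 1 / 2" and "l \<noteq> 0" and "1 < p"
    and "\<And>t. t > 0 \<Longrightarrow> w t = t powr \<alpha>"
  shows "(w \<in> muckenhoupt_A p \<longleftrightarrow> - 1 < \<alpha> \<and> \<alpha> < p - 1) \<and>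
         (w \<in> muckenhoupt_A_lam p l \<longleftrightarrow> - 1 - p < \<alpha> \<and> \<alpha> < p - 1 + 2 * l * p) \<and>
         (w \<in> muckenhoupt_A_tilde p l \<longleftrightarrow> - 1 < \<alpha> \<and> \<alpha> < p - 1 + (2 * l + 1) * p)"
proof (intro conjI)
  note p = \<open>1 < p\<close>
  note integrals = weight_integrals[OF assms(4) p, simplified]
  have weight: "weight w" using assms(4) by (rule weight_powr)
  have \<kappa>: "- 1 < 2 * l + 1" using assms(1) by simp

  \<comment> \<open>Here \<gamma> = \<alpha>, \<delta> = -\<alpha>/(p - 1) and \<kappa> = 0, since
    the length of an interval is the integral of t^0.\<close>
  have "w \<in> muckenhoupt_A p \<longleftrightarrow> (\<exists>C>0. \<forall>a b. 0 \<le> a \<and> a < b \<longrightarrow>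
      power_integral \<alpha> a b / power_integral 0 a b *
      (power_integral (- \<alpha> / (p - 1)) a b / power_integral 0 a b) epowr (p - 1) < ennreal C)"
    (is "_ \<longleftrightarrow> (\<exists>C>0. \<forall>a b. 0 \<le> a \<and> a < b \<longrightarrow> ?Q a b < ennreal C)")
  proof -
    have "w \<in> muckenhoupt_A p \<longleftrightarrow> (SUP B\<in>Rplus_intervals.
        ((\<integral>\<^sup>+t\<in>B. ennreal (w t) \<partial>lebesgue) / emeasure lebesgue B) *
        ((\<integral>\<^sup>+t\<in>B. ennreal (w t) epowr (- 1 / (p - 1)) \<partial>lebesgue)
            / emeasure lebesgue B) epowr (p - 1)) < \<infinity>" (is "_ \<longleftrightarrow> (SUP B\<in>_. ?R B) < _")
      using weight by (simp add: muckenhoupt_A_def)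
    also have "\<dots> \<longleftrightarrow> (\<exists>C>0. \<forall>B\<in>Rplus_intervals. ?R B < ennreal C)"
      unfolding infinity_ennreal_def by (rule SUP_less_top_iff_bounded)
    also have "\<dots> \<longleftrightarrow> (\<exists>C>0. \<forall>a b. 0 \<le> a \<and> a < b \<longrightarrow> ?R {a<..<b} < ennreal C)"
      by (simp only: ball_Rplus_intervals)
    also have "?R {a<..<b} = ?Q a b" if "0 \<le> a" "a < b" for a b
      using that by (simp add: integrals power_integral_eq)
    then have "(\<exists>C>0. \<forall>a b. 0 \<le> a \<and> a < b \<longrightarrow> ?R {a<..<b} < ennreal C) \<longleftrightarrow>
        (\<exists>C>0. \<forall>a b. 0 \<le> a \<and> a < b \<longrightarrow> ?Q a b < ennreal C)"
      by (intro ex_cong1 conj_cong all_cong1 imp_cong refl) auto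
    finally show ?thesis .
  qed
  also have "\<dots> \<longleftrightarrow> - 1 < \<alpha> \<and> - 1 < - \<alpha> / (p - 1)"
    using p by (intro muckenhoupt_power_normalized_iff) auto
  also have "- 1 < - \<alpha> / (p - 1) \<longleftrightarrow> \<alpha> < p - 1"
    using p by (simp add: field_simps)
  finally show "w \<in> muckenhoupt_A p \<longleftrightarrow> - 1 < \<alpha> \<and> \<alpha> < p - 1" .

  \<comment> \<open>Here \<gamma> = p + \<alpha> and \<kappa> = 2l + 1; homogeneity reads (p +
    \<alpha>) + (2lp - \<alpha>) = p (2l + 1).\<close>
  let ?\<delta> = "2 * l * conj_exp p - \<alpha> / (p - 1)"
  note \<delta> = dual_exponent[OF p, of "2 * l" \<alpha>]
  \<comment> \<open>The difference of powers is 2l + 2 times the integral of t^(2l + 1), hence the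
    factor (2l + 2)^p.\<close>
  have rhs: "ennreal (C * (b powr (2 * (l + 1)) - a powr (2 * (l + 1))) powr p)
      = ennreal (C * (2 * l + 2) powr p) * power_integral (2 * l + 1) a b epowr p"
    if "0 < a" "a < b" for a b C
  proof -
    have "a powr (2 * l + 2) < b powr (2 * l + 2)"
      using that assms(1) by (intro powr_less_mono2) auto
    then show ?thesis
      using that assms(1) p
      by (simp add: power_integral_eq epowr_ennreal powr_divide algebra_simps flip: ennreal_mult'')
  qed
  have A_lam: "w \<in> muckenhoupt_A_lam p l \<longleftrightarrow> (\<exists>C>0. \<forall>a b. 0 < a \<and> a < b \<longrightarrow>
      power_integral (p + \<alpha>) a b * power_integral ?\<delta> a b epowr (p - 1)
        < ennreal (C * (2 * l + 2) powr p) * power_integral (2 * l + 1) a b epowr p)"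
    using weight by (simp add: muckenhoupt_A_lam_def integrals flip: rhs)
  show "w \<in> muckenhoupt_A_lam p l \<longleftrightarrow> - 1 - p < \<alpha> \<and> \<alpha> < p - 1 + 2 * l * p"
  proof
    assume "w \<in> muckenhoupt_A_lam p l"
    then obtain C where "\<And>a b. 0 < a \<Longrightarrow> a < b \<Longrightarrow>
      power_integral (p + \<alpha>) a b * power_integral ?\<delta> a b epowr (p - 1)
        < ennreal (C * (2 * l + 2) powr p) * power_integral (2 * l + 1) a b epowr p"
      unfolding A_lam by blast
    from muckenhoupt_power_necessary[OF p \<kappa> this]
    show "- 1 - p < \<alpha> \<and> \<alpha> < p - 1 + 2 * l * p"
      using \<delta>(2) by auto
  next
    assume "- 1 - p < \<alpha> \<and> \<alpha> < p - 1 + 2 * l * p"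
    then obtain C where C: "0 < C" "\<And>a b. 0 \<le> a \<Longrightarrow> a < b \<Longrightarrow>
      power_integral (p + \<alpha>) a b * power_integral ?\<delta> a b epowr (p - 1)
        < ennreal C * power_integral (2 * l + 1) a b epowr p"
      using muckenhoupt_power_sufficient[OF p _ _ \<kappa>, of "p + \<alpha>" ?\<delta>] \<delta>
      by (auto simp: algebra_simps)
    have pos: "0 < (2 * l + 2) powr p" using assms(1) by simp
    show "w \<in> muckenhoupt_A_lam p l"
      \<comment> \<open>The witness cancels the factor (2l + 2)^p carried by the constant in
        \<open>A_lam\<close>.\<close>
      unfolding A_lam using C pos by (intro exI[of _ "C / (2 * l + 2) powr p"]) auto
  qed

  \<comment> \<open>Here \<gamma> = \<alpha> and \<kappa> = 2l + 1, the exponent of the density of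
    \<open>nu\<close>; homogeneity reads \<alpha> + ((2l + 1) p - \<alpha>) = p (2l + 1).\<close>
  let ?\<delta>' = "(2 * l + 1) * conj_exp p - \<alpha> / (p - 1)"
  note \<delta>' = dual_exponent[OF p, of "2 * l + 1" \<alpha>]
  have "w \<in> muckenhoupt_A_tilde p l \<longleftrightarrow> (\<exists>C>0. \<forall>a b. 0 \<le> a \<and> a < b \<longrightarrow>
      power_integral \<alpha> a b / power_integral (2 * l + 1) a b *
      (power_integral ?\<delta>' a b / power_integral (2 * l + 1) a b) epowr (p - 1) < ennreal C)"
    (is "_ \<longleftrightarrow> (\<exists>C>0. ?P C)")
  proof -
    have "(\<forall>B \<in> Rplus_intervals.
        ((\<integral>\<^sup>+t\<in>B. ennreal (w t) \<partial>lebesgue) / nu l B) *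
        ((\<integral>\<^sup>+t\<in>B. ennreal (t powr ((2 * l + 1) * conj_exp p))
            * ennreal (w t) epowr (- 1 / (p - 1)) \<partial>lebesgue) / nu l B) epowr (p - 1)
        < ennreal C) \<longleftrightarrow> ?P C" for C
      unfolding ball_Rplus_intervals by (simp add: integrals nu_Ioo)
    then show ?thesis using weight by (simp add: muckenhoupt_A_tilde_def)
  qed
  also have "\<dots> \<longleftrightarrow> - 1 < \<alpha> \<and> - 1 < ?\<delta>'"
    by (intro muckenhoupt_power_normalized_iff p \<kappa>) (simp add: \<delta>'(1))
  finally show "w \<in> muckenhoupt_A_tilde p l \<longleftrightarrow> - 1 < \<alpha> \<and> \<alpha> < p - 1 + (2 * l + 1) * p"
    unfolding \<delta>'(2) .
qed

end
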